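(* Let $V_{\mathbb H}^R$ and $U_{\mathbb H}^R$ be separable right quaternionic Hilbert spaces and let $A\in\mathcal B(V_{\mathbb H}^R,U_{\mathbb H}^R)$ be a Fredholm operator. Then there exists a constant $c>0$ such that for every operator $S\in\mathcal B(V_{\mathbb H}^R,U_{\mathbb H}^R)$ with $\|S\|<c$, $A+S$ is a Fredholm operator and $\mathrm{ind}(A+S)=\mathrm{ind}(A)$.
   Context: $\mathbb H$ denotes the quaternions. A right quaternionic Hilbert space is a right $\mathbb H$-vector space, complete for the norm of an $\mathbb H$-valued inner product $\langle\cdot|\cdot\rangle$ satisfying $\overline{\langle\phi|\psi\rangle}=\langle\psi|\phi\rangle$, $\|\phi\|^2=\langle\phi|\phi\rangle>0$ for $\phi\ne0$, additivity, $\langle\phi|\psi\mathfrak q\rangle=\langle\phi|\psi\rangle\mathfrak q$ and $\langle\phi\mathfrak q|\psi\rangle=\overline{\mathfrak q}\langle\phi|\psi\rangle$. $\mathcal B(V_{\mathbb H}^R,U_{\mathbb H}^R)$ is the set of bounded right $\mathbb H$-linear operators from $V_{\mathbb H}^R$ to $U_{\mathbb H}^R$, with the operator norm $\|\cdot\|$. An operator $A\in\mathcal B(V_{\mathbb H}^R,U_{\mathbb H}^R)$ is Fredholm if $\ker(A)$ and $\mathrm{coker}(A)=U_{\mathbb H}^R/\mathrm{ran}(A)$ are finite dimensional (over $\mathbb H$); its index is $\mathrm{ind}(A)=\dim\ker(A)-\dim\mathrm{coker}(A)$. *)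

theory Defs
  imports "HOL-Analysis.Analysis" "HOL-Library.Set_Algebras"
begin

section \<open>Quaternions\<close>

text \<open>\<open>Quat a b c d\<close> stands for \<open>a + b i + c j + d k\<close>.\<close>

datatype quat = Quat (qre: real) (qim1: real) (qim2: real) (qim3: real)

lemma quat_eq_iff:
  "p = q \<longleftrightarrow> qre p = qre q \<and> qim1 p = qim1 q \<and> qim2 p = qim2 q \<and> qim3 p = qim3 q"
  by (cases p; cases q) auto

instantiation quat :: ab_group_add
begin

definition "0 = Quat 0 0 0 0"

definition "p + q = Quat (qre p + qre q) (qim1 p + qim1 q) (qim2 p + qim2 q) (qim3 p + qim3 q)"

definition "- p = Quat (- qre p) (- qim1 p) (- qim2 p) (- qim3 p)"

definition "p - q = Quat (qre p - qre q) (qim1 p - qim1 q) (qim2 p - qim2 q) (qim3 p - qim3 q)"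

instance
  by standard
    (simp_all add: quat_eq_iff zero_quat_def plus_quat_def uminus_quat_def minus_quat_def)

end

instantiation quat :: real_div_algebra
begin

definition "scaleR r q = Quat (r * qre q) (r * qim1 q) (r * qim2 q) (r * qim3 q)"

definition "1 = Quat 1 0 0 0"

definition "p * q = Quat
  (qre p * qre q - qim1 p * qim1 q - qim2 p * qim2 q - qim3 p * qim3 q)
  (qre p * qim1 q + qim1 p * qre q + qim2 p * qim3 q - qim3 p * qim2 q)
  (qre p * qim2 q - qim1 p * qim3 q + qim2 p * qre q + qim3 p * qim1 q)
  (qre p * qim3 q + qim1 p * qim2 q - qim2 p * qim1 q + qim3 p * qre q)"

definition "inverse q =
  (let n = (qre q)\<^sup>2 + (qim1 q)\<^sup>2 + (qim2 q)\<^sup>2 + (qim3 q)\<^sup>2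
   in Quat (qre q / n) (- qim1 q / n) (- qim2 q / n) (- qim3 q / n))"

definition "p div q = p * inverse q" for p q :: quat

instance
proof
  fix q :: quat
  let ?n = "(qre q)\<^sup>2 + (qim1 q)\<^sup>2 + (qim2 q)\<^sup>2 + (qim3 q)\<^sup>2"
  assume "q \<noteq> 0"
  then have "?n \<noteq> 0"
    by (auto simp: quat_eq_iff zero_quat_def add_nonneg_eq_0_iff)
  then have n: "qre q * qre q / ?n + qim1 q * qim1 q / ?n + qim2 q * qim2 q / ?n
      + qim3 q * qim3 q / ?n = 1"
    by (simp add: power2_eq_square flip: add_divide_distrib)
  show "inverse q * q = 1" "q * inverse q = 1"
    using n by (simp_all add: quat_eq_iff times_quat_def one_quat_def inverse_quat_def Let_def
        mult.commute)
qed (simp_all add: quat_eq_iff zero_quat_def one_quat_def plus_quat_def times_quat_def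
      scaleR_quat_def inverse_quat_def divide_quat_def algebra_simps)

end

definition qcnj :: "quat \<Rightarrow> quat" where
  "qcnj q = Quat (qre q) (- qim1 q) (- qim2 q) (- qim3 q)"


section \<open>Right quaternionic Hilbert spaces\<close>

text \<open>
  Completeness comes from \<^class>\<open>banach\<close>, whose norm is tied to the inner product by
  \<open>qinner_self\<close>; this equation contains both \<open>\<langle>x|x\<rangle> = \<parallel>x\<parallel>\<^sup>2\<close> and positivity. The real
  scalar multiplication of the class \<^class>\<open>banach\<close> is the restriction of the quaternionic one.
\<close>

class right_qhilbert = banach +
  fixes scaleQ :: "'a \<Rightarrow> quat \<Rightarrow> 'a"  (infixl \<open>*\<^sub>Q\<close> 75)
    and qinner :: "'a \<Rightarrow> 'a \<Rightarrow> quat"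
  assumes scaleQ_add_left: "(x + y) *\<^sub>Q p = x *\<^sub>Q p + y *\<^sub>Q p"
    and scaleQ_add_right: "x *\<^sub>Q (p + q) = x *\<^sub>Q p + x *\<^sub>Q q"
    and scaleQ_scaleQ: "x *\<^sub>Q p *\<^sub>Q q = x *\<^sub>Q (p * q)"
    and scaleQ_one: "x *\<^sub>Q 1 = x"
    and scaleQ_of_real: "x *\<^sub>Q of_real r = r *\<^sub>R x"
    and qinner_commute: "qcnj (qinner x y) = qinner y x"
    and qinner_self: "qinner x x = of_real ((norm x)\<^sup>2)"
    and qinner_add_right: "qinner x (y + z) = qinner x y + qinner x z"
    and qinner_scaleQ_right: "qinner x (y *\<^sub>Q q) = qinner x y * q"
    and qinner_scaleQ_left: "qinner (x *\<^sub>Q q) y = qcnj q * qinner x y"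

definition bounded_right_linear ::
    "('v::right_qhilbert \<Rightarrow> 'u::right_qhilbert) \<Rightarrow> bool" where
  "bounded_right_linear A \<longleftrightarrow> bounded_linear A \<and> (\<forall>x q. A (x *\<^sub>Q q) = A x *\<^sub>Q q)"


section \<open>Dimension of right quaternionic vector spaces\<close>

text \<open>
  The library's vector spaces are over commutative fields. The structures below have explicit
  carriers, so that both a kernel (a set of vectors) and a cokernel (a set of cosets) are
  instances.
\<close>

record 'a right_qspace =
  qcarrier :: "'a set"
  qadd :: "'a \<Rightarrow> 'a \<Rightarrow> 'a"
  qzero :: 'a
  qscale :: "'a \<Rightarrow> quat \<Rightarrow> 'a"

definition right_qvector_space :: "'a right_qspace \<Rightarrow> bool" where
  "right_qvector_space W \<longleftrightarrow>
     qzero W \<in> qcarrier W \<and>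
     (\<forall>x\<in>qcarrier W. \<forall>y\<in>qcarrier W. qadd W x y \<in> qcarrier W \<and> qadd W x y = qadd W y x) \<and>
     (\<forall>x\<in>qcarrier W. \<forall>y\<in>qcarrier W. \<forall>z\<in>qcarrier W.
        qadd W (qadd W x y) z = qadd W x (qadd W y z)) \<and>
     (\<forall>x\<in>qcarrier W. qadd W (qzero W) x = x \<and> (\<exists>y\<in>qcarrier W. qadd W x y = qzero W)) \<and>
     (\<forall>x\<in>qcarrier W. \<forall>p. qscale W x p \<in> qcarrier W) \<and>
     (\<forall>x\<in>qcarrier W. \<forall>y\<in>qcarrier W. \<forall>p.
        qscale W (qadd W x y) p = qadd W (qscale W x p) (qscale W y p)) \<and>
     (\<forall>x\<in>qcarrier W. \<forall>p q.
        qscale W x (p + q) = qadd W (qscale W x p) (qscale W x q) \<and>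
        qscale W (qscale W x p) q = qscale W x (p * q)) \<and>
     (\<forall>x\<in>qcarrier W. qscale W x 1 = x)"

definition qsubspace :: "'a right_qspace \<Rightarrow> 'a set \<Rightarrow> bool" where
  "qsubspace W S \<longleftrightarrow> S \<subseteq> qcarrier W \<and> qzero W \<in> S \<and>
     (\<forall>x\<in>S. \<forall>y\<in>S. qadd W x y \<in> S) \<and> (\<forall>x\<in>S. \<forall>q. qscale W x q \<in> S)"

definition qspan :: "'a right_qspace \<Rightarrow> 'a set \<Rightarrow> 'a set" where
  "qspan W B = qsubspace W hull B"

definition qbasis :: "'a right_qspace \<Rightarrow> 'a set \<Rightarrow> bool" where
  "qbasis W B \<longleftrightarrow> B \<subseteq> qcarrier W \<and> (\<forall>b\<in>B. b \<notin> qspan W (B - {b})) \<and> qspan W B = qcarrier W"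

definition finite_qdim :: "'a right_qspace \<Rightarrow> bool" where
  "finite_qdim W \<longleftrightarrow> (\<exists>B. finite B \<and> qbasis W B)"

text \<open>Only meaningful for finite-dimensional spaces.\<close>

definition qdim :: "'a right_qspace \<Rightarrow> nat" where
  "qdim W = card (SOME B. finite B \<and> qbasis W B)"


section \<open>Kernel, cokernel and Fredholm operators\<close>

definition ker_qspace ::
    "('v::right_qhilbert \<Rightarrow> 'u::right_qhilbert) \<Rightarrow> 'v right_qspace" where
  "ker_qspace A = \<lparr>qcarrier = {x. A x = 0}, qadd = (+), qzero = 0, qscale = (*\<^sub>Q)\<rparr>"

text \<open>
  The quotient of the whole space by a subspace \<open>R\<close>, not necessarily closed. Its elements are the
  cosets \<open>u + R\<close>, and their sum is the Minkowski sum. Adding \<open>R\<close> in the scalar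
  multiplication matters only for the scalar \<open>0\<close>, where the image of a coset is \<open>{0}\<close>
  instead of \<open>R\<close>.
\<close>

definition quotient_qspace :: "'u::right_qhilbert set \<Rightarrow> 'u set right_qspace" where
  "quotient_qspace R =
     \<lparr>qcarrier = range (\<lambda>u. u +o R), qadd = (+), qzero = R,
      qscale = (\<lambda>C q. (\<lambda>u. u *\<^sub>Q q) ` C + R)\<rparr>"

definition coker_qspace ::
    "('v::right_qhilbert \<Rightarrow> 'u::right_qhilbert) \<Rightarrow> 'u set right_qspace" where
  "coker_qspace A = quotient_qspace (range A)"

definition fredholm :: "('v::right_qhilbert \<Rightarrow> 'u::right_qhilbert) \<Rightarrow> bool" where
  "fredholm A \<longleftrightarrow> bounded_right_linear A \<and>
     finite_qdim (ker_qspace A) \<and> finite_qdim (coker_qspace A)"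

definition fredholm_index :: "('v::right_qhilbert \<Rightarrow> 'u::right_qhilbert) \<Rightarrow> int" where
  "fredholm_index A = int (qdim (ker_qspace A)) - int (qdim (coker_qspace A))"


section \<open>Kernel and cokernel are right quaternionic vector spaces\<close>

lemma scaleQ_zero_left: "0 *\<^sub>Q q = (0::'a::right_qhilbert)"
  using scaleQ_add_left[of 0 0 q] by simp

lemma scaleQ_zero_right: "x *\<^sub>Q 0 = (0::'a::right_qhilbert)"
  using scaleQ_of_real[of x 0] by simp

lemma right_qvector_space_ker:
  assumes "bounded_right_linear A"
  shows "right_qvector_space (ker_qspace A)"
proof -
  interpret bounded_linear A
    using assms by (simp add: bounded_right_linear_def)
  have sc: "A (x *\<^sub>Q q) = A x *\<^sub>Q q" for x q
    using assms by (simp add: bounded_right_linear_def)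
  have "\<exists>y. A y = 0 \<and> x + y = 0" if "A x = 0" for x
    using that by (intro exI[of _ "- x"]) (simp add: neg)
  then show ?thesis
    by (auto simp: right_qvector_space_def ker_qspace_def zero add sc scaleQ_zero_left
        scaleQ_add_left scaleQ_add_right scaleQ_scaleQ scaleQ_one algebra_simps)
qed

lemma
  fixes R :: "'u::right_qhilbert set"
  assumes "0 \<in> R" and add: "\<And>x y. x \<in> R \<Longrightarrow> y \<in> R \<Longrightarrow> x + y \<in> R"
    and scale: "\<And>x q. x \<in> R \<Longrightarrow> x *\<^sub>Q q \<in> R"
  shows quotient_qspace_add: "(u +o R) + (v +o R) = (u + v) +o R"
    and quotient_qspace_scale: "(\<lambda>u. u *\<^sub>Q q) ` (u +o R) + R = (u *\<^sub>Q q) +o R"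
proof -
  show "(u +o R) + (v +o R) = (u + v) +o R"
  proof (intro set_eqI iffI)
    fix x assume "x \<in> (u +o R) + (v +o R)"
    then obtain r s where "r \<in> R" "s \<in> R" "x = (u + r) + (v + s)"
      by (auto simp: elt_set_plus_def set_plus_def)
    then have "x = (u + v) + (r + s)" "r + s \<in> R"
      using add by (simp_all add: algebra_simps)
    then show "x \<in> (u + v) +o R"
      unfolding elt_set_plus_def by blast
  next
    fix x assume "x \<in> (u + v) +o R"
    then obtain r where "r \<in> R" "x = (u + r) + (v + 0)"
      by (auto simp: elt_set_plus_def algebra_simps)
    then show "x \<in> (u +o R) + (v +o R)"
      using \<open>0 \<in> R\<close> unfolding elt_set_plus_def set_plus_def by blast
  qed
  show "(\<lambda>u. u *\<^sub>Q q) ` (u +o R) + R = (u *\<^sub>Q q) +o R"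
  proof (intro set_eqI iffI)
    fix x assume "x \<in> (\<lambda>u. u *\<^sub>Q q) ` (u +o R) + R"
    then obtain r s where "r \<in> R" "s \<in> R" "x = (u + r) *\<^sub>Q q + s"
      by (auto simp: elt_set_plus_def set_plus_def)
    then have "x = u *\<^sub>Q q + (r *\<^sub>Q q + s)" "r *\<^sub>Q q + s \<in> R"
      using add scale by (simp_all add: scaleQ_add_left algebra_simps)
    then show "x \<in> (u *\<^sub>Q q) +o R"
      unfolding elt_set_plus_def by blast
  next
    fix x assume "x \<in> (u *\<^sub>Q q) +o R"
    then obtain r where "r \<in> R" "x = (u + 0) *\<^sub>Q q + r"
      by (auto simp: elt_set_plus_def)
    then show "x \<in> (\<lambda>u. u *\<^sub>Q q) ` (u +o R) + R"
      using \<open>0 \<in> R\<close> unfolding elt_set_plus_def set_plus_def by blast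
  qed
qed

lemma right_qvector_space_coker:
  assumes "bounded_right_linear A"
  shows "right_qvector_space (coker_qspace A)"
proof -
  interpret bounded_linear A
    using assms by (simp add: bounded_right_linear_def)
  let ?R = "range A"
  have sc: "A x *\<^sub>Q q = A (x *\<^sub>Q q)" for x q
    using assms by (simp add: bounded_right_linear_def)
  have R: "0 \<in> ?R" "\<And>x y. x \<in> ?R \<Longrightarrow> y \<in> ?R \<Longrightarrow> x + y \<in> ?R"
      "\<And>x q. x \<in> ?R \<Longrightarrow> x *\<^sub>Q q \<in> ?R"
    using zero[symmetric] by (blast, auto simp: sc simp flip: add)
  have coset: "(u +o ?R) + (v +o ?R) = (u + v) +o ?R"
      "(\<lambda>u. u *\<^sub>Q q) ` (u +o ?R) + ?R = (u *\<^sub>Q q) +o ?R" for u v q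
    using quotient_qspace_add[OF R] quotient_qspace_scale[OF R] by blast+
  have zero_coset: "0 +o ?R = ?R"
    by (simp add: elt_set_plus_def)
  have zero_add: "?R + (u +o ?R) = u +o ?R" for u
    using coset(1)[of 0 u] by (simp only: zero_coset add_0)
  have minus: "(u +o ?R) + (- u +o ?R) = ?R" for u
    by (simp only: coset zero_coset right_minus)
  have inv: "\<exists>v. (u +o ?R) + (v +o ?R) = ?R" for u
    using minus by blast
  show ?thesis
    unfolding right_qvector_space_def coker_qspace_def quotient_qspace_def right_qspace.simps
    using zero_coset inv
    by (simp only: ball_simps bex_simps coset zero_add)
      (auto simp only: coset scaleQ_add_left scaleQ_add_right scaleQ_scaleQ scaleQ_one ac_simps)
qed

end

theory Submission
  imports Defs
begin

text \<open>
  A Fredholm operator becomes invertible after a finite-dimensional modification, and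
  invertibility is stable under small perturbations. Let \<open>M\<close> be a closed complement of \<open>ker A\<close>
  in \<open>V\<close> and \<open>Z\<close> a finite-dimensional complement of \<open>ran A\<close> in \<open>U\<close>. Then the bounded
  operator \<open>(m, z) \<mapsto> A m + z\<close> from \<open>M \<times> Z\<close> to \<open>U\<close> is bijective. By the open mapping theorem
  its inverse is bounded, and Banach's fixed point theorem shows that \<open>(m, z) \<mapsto> (A + S) m + z\<close>
  is still bijective if \<open>S\<close> is small (\<open>bij_on_closed_subspace_perturb\<close>). In other words,
  \<open>A + S\<close> is injective on the same \<open>M\<close>, and the same \<open>Z\<close> is a complement of the image of \<open>M\<close>.

  For every operator \<open>B\<close> with these two properties, linear algebra gives finite-dimensional kernel
  and cokernel, and \<open>ind B = dim (V / M) - dim Z\<close> (\<open>fredholm_index_of_complements\<close>). This number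
  depends only on \<open>M\<close> and \<open>Z\<close>, so it is the same for \<open>A + S\<close> and for \<open>A\<close>.

  The argument rests on two further developments. Dimension theory over the noncommutative
  quaternions is set up for quotients of two subspaces of one space
  (\<open>quotient_dim\<close>), and linked to bases of kernels and cokernels afterwards. Closedness
  of \<open>Z\<close> and of a complement of \<open>ker A\<close> comes from bounded right linear projections onto
  finite-dimensional subspaces, built by a Gram-Schmidt process (\<open>finite_dim_projection\<close>).
\<close>

section \<open>Right quaternionic subspaces\<close>

definition right_subspace :: "'a::right_qhilbert set \<Rightarrow> bool" where
  "right_subspace X \<longleftrightarrow> 0 \<in> X \<and> (\<forall>x\<in>X. \<forall>y\<in>X. x + y \<in> X) \<and> (\<forall>x\<in>X. \<forall>q. x *\<^sub>Q q \<in> X)"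

lemma right_subspaceI:
  assumes "0 \<in> X" "\<And>x y. x \<in> X \<Longrightarrow> y \<in> X \<Longrightarrow> x + y \<in> X" "\<And>x q. x \<in> X \<Longrightarrow> x *\<^sub>Q q \<in> X"
  shows "right_subspace X"
  using assms by (auto simp: right_subspace_def)

lemma
  assumes "right_subspace X"
  shows right_subspace_0: "0 \<in> X"
    and right_subspace_add: "x \<in> X \<Longrightarrow> y \<in> X \<Longrightarrow> x + y \<in> X"
    and right_subspace_scaleQ: "x \<in> X \<Longrightarrow> x *\<^sub>Q q \<in> X"
  using assms by (auto simp: right_subspace_def)

lemma scaleQ_uminus_right: "x *\<^sub>Q (- q) = - (x *\<^sub>Q q)"
  for x :: "'a::right_qhilbert"
  using scaleQ_add_right[of x q "- q"] by (simp add: scaleQ_zero_right eq_neg_iff_add_eq_0 add.commute)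

lemma scaleQ_uminus_left: "(- x) *\<^sub>Q q = - (x *\<^sub>Q q)"
  for x :: "'a::right_qhilbert"
  using scaleQ_add_left[of x "- x" q] by (simp add: scaleQ_zero_left eq_neg_iff_add_eq_0 add.commute)

lemma scaleQ_diff_left: "(x - y) *\<^sub>Q q = x *\<^sub>Q q - y *\<^sub>Q q"
  for x :: "'a::right_qhilbert"
  using scaleQ_add_left[of x "- y" q] by (simp add: scaleQ_uminus_left)

lemma right_subspace_uminus: "right_subspace X \<Longrightarrow> x \<in> X \<Longrightarrow> - x \<in> X"
  using right_subspace_scaleQ[of X x "- 1"] by (simp add: scaleQ_uminus_right scaleQ_one)

lemma right_subspace_diff: "right_subspace X \<Longrightarrow> x \<in> X \<Longrightarrow> y \<in> X \<Longrightarrow> x - y \<in> X"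
  using right_subspace_add[of X x "- y"] right_subspace_uminus by auto

lemma right_subspace_scaleR: "right_subspace X \<Longrightarrow> x \<in> X \<Longrightarrow> r *\<^sub>R x \<in> X"
  using right_subspace_scaleQ[of X x "of_real r"] by (simp add: scaleQ_of_real)

lemma right_subspace_real_subspace: "right_subspace X \<Longrightarrow> subspace X"
  by (simp add: subspace_def right_subspace_0 right_subspace_add right_subspace_scaleR)

lemma right_subspace_zero: "right_subspace {0}"
  by (simp add: right_subspace_def scaleQ_zero_left)

lemma right_subspace_UNIV: "right_subspace UNIV"
  by (simp add: right_subspace_def)

lemma right_subspace_Int: "right_subspace X \<Longrightarrow> right_subspace Y \<Longrightarrow> right_subspace (X \<inter> Y)"
  by (simp add: right_subspace_def)

lemma right_subspace_plus:
  assumes "right_subspace X" "right_subspace Y"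
  shows "right_subspace (X + Y)"
proof (rule right_subspaceI)
  show "0 \<in> X + Y"
    using set_plus_intro[OF right_subspace_0 right_subspace_0] assms by fastforce
next
  fix a b assume "a \<in> X + Y" "b \<in> X + Y"
  then obtain x y x' y' where "x \<in> X" "y \<in> Y" "x' \<in> X" "y' \<in> Y" "a = x + y" "b = x' + y'"
    by (auto elim!: set_plus_elim)
  moreover have "a + b = (x + x') + (y + y')"
    using calculation by simp
  ultimately show "a + b \<in> X + Y"
    using assms by (metis set_plus_intro right_subspace_add)
next
  fix a q assume "a \<in> X + Y"
  then show "a *\<^sub>Q q \<in> X + Y"
    using assms by (auto elim!: set_plus_elim simp: scaleQ_add_left right_subspace_scaleQ set_plus_intro)
qed

definition right_line :: "'a::right_qhilbert \<Rightarrow> 'a set" where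
  "right_line x = range (\<lambda>q. x *\<^sub>Q q)"

lemma right_subspace_line: "right_subspace (right_line x)"
proof (rule right_subspaceI)
  show "0 \<in> right_line x"
    unfolding right_line_def using scaleQ_zero_right[of x] by (metis rangeI)
qed (auto simp: right_line_def scaleQ_scaleQ simp flip: scaleQ_add_right)

lemma mem_right_line: "x \<in> right_line x"
  unfolding right_line_def using scaleQ_one[of x] by (metis rangeI)

lemma plus_line_iff: "w \<in> X + right_line x \<longleftrightarrow> (\<exists>y\<in>X. \<exists>q. w = y + x *\<^sub>Q q)"
  by (auto simp: right_line_def set_plus_def)

lemma subset_plus_left: "right_subspace Y \<Longrightarrow> X \<subseteq> X + Y"
  by (metis set_zero_plus2 right_subspace_0 add.commute)

lemma subset_plus_right: "right_subspace X \<Longrightarrow> Y \<subseteq> X + Y"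
  by (simp add: set_zero_plus2 right_subspace_0)

lemma plus_subset:
  "right_subspace W \<Longrightarrow> X \<subseteq> W \<Longrightarrow> Y \<subseteq> W \<Longrightarrow> X + Y \<subseteq> W"
  by (auto elim!: set_plus_elim intro: right_subspace_add)

lemma line_subset: "right_subspace W \<Longrightarrow> x \<in> W \<Longrightarrow> right_line x \<subseteq> W"
  by (auto simp: right_line_def right_subspace_scaleQ)

text \<open>
  The exchange property: a nonzero coefficient of \<open>x\<close> in \<open>a\<close> can be inverted, since the
  quaternions form a division ring. All independence arguments below rest on it.
\<close>

lemma mem_line_exchange:
  assumes X: "right_subspace X" and a: "a \<in> X + right_line x" "a \<notin> X"
  shows "x \<in> X + right_line a"
proof -
  obtain y q where y: "y \<in> X" "a = y + x *\<^sub>Q q"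
    using a(1) by (auto simp: plus_line_iff)
  have "q \<noteq> 0"
    using y a(2) by (auto simp: scaleQ_zero_right)
  then have "x = - (y *\<^sub>Q inverse q) + a *\<^sub>Q inverse q"
    by (simp add: y scaleQ_add_left scaleQ_scaleQ scaleQ_one)
  moreover have "- (y *\<^sub>Q inverse q) \<in> X"
    using X y(1) by (simp add: right_subspace_uminus right_subspace_scaleQ)
  ultimately show ?thesis
    unfolding plus_line_iff by blast
qed

lemma plus_line_eq:
  assumes X: "right_subspace X" and a: "a \<in> X + right_line x" "a \<notin> X"
  shows "X + right_line a = X + right_line x"
proof (rule antisym)
  have *: "right_subspace (X + right_line z)" for z
    by (intro right_subspace_plus right_subspace_line X)
  show "X + right_line a \<subseteq> X + right_line x"
    by (intro plus_subset * line_subset subset_plus_left right_subspace_line a(1))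
  show "X + right_line x \<subseteq> X + right_line a"
    by (intro plus_subset * line_subset subset_plus_left right_subspace_line mem_line_exchange[OF X a])
qed

section \<open>Dimension of a quotient of subspaces\<close>

text \<open>
  \<open>quotient_dim Y X n\<close> stands for \<open>dim (X / Y) = n\<close>, witnessed by a chain of subspaces from \<open>Y\<close> to
  \<open>X\<close> that grows by one dimension in each of \<open>n\<close> steps. Compared with bases, chains make it
  possible to treat kernels (\<open>Y = {0}\<close>) and cokernels (\<open>X = UNIV\<close>) alike without forming
  quotients, and the isomorphism theorems become inductions along the chain.
\<close>

inductive quotient_dim :: "'a::right_qhilbert set \<Rightarrow> 'a set \<Rightarrow> nat \<Rightarrow> bool" for Y where
  quotient_dim_0: "right_subspace Y \<Longrightarrow> quotient_dim Y Y 0"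
| quotient_dim_Suc: "quotient_dim Y X n \<Longrightarrow> x \<notin> X \<Longrightarrow> quotient_dim Y (X + right_line x) (Suc n)"

lemma quotient_dim_right_subspace:
  assumes "quotient_dim Y X n"
  shows "right_subspace Y" and "right_subspace X" and "Y \<subseteq> X"
proof -
  have "right_subspace Y \<and> right_subspace X \<and> Y \<subseteq> X"
    using assms
  proof induction
    case (quotient_dim_Suc X n x)
    then show ?case
      using subset_plus_left[OF right_subspace_line, of X x]
      by (auto intro: right_subspace_plus right_subspace_line)
  qed simp
  then show "right_subspace Y" and "right_subspace X" and "Y \<subseteq> X"
    by auto
qed

lemma quotient_dim_self:
  assumes "quotient_dim X X n"
  shows "n = 0"
  using assms
proof cases
  case (quotient_dim_Suc W m x)
  note W = quotient_dim_right_subspace(2,3)[OF quotient_dim_Suc(3)]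
  have "x \<in> X"
    using quotient_dim_Suc(1) mem_right_line[of x] subset_plus_right[OF W(1), of "right_line x"] by blast
  then show ?thesis
    using quotient_dim_Suc(4) W(2) by blast
qed simp

text \<open>
  One half of the second isomorphism theorem, in a slightly more general form: adding \<open>P\<close> to
  every member of the chain keeps all steps proper, because \<open>P\<close> meets \<open>X\<close> only inside \<open>Y\<close>.
\<close>

lemma quotient_dim_plus:
  assumes "quotient_dim Y X n" and P: "right_subspace P" and "X \<inter> P \<subseteq> Y"
  shows "quotient_dim (Y + P) (X + P) n"
  using assms(1,3)
proof induction
  case quotient_dim_0
  then show ?case
    using P by (simp add: quotient_dim.quotient_dim_0 right_subspace_plus)
next
  case (quotient_dim_Suc X n x)
  note X = quotient_dim_right_subspace(2)[OF quotient_dim_Suc.hyps(1)]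
  have YX: "Y \<subseteq> X"
    using quotient_dim_Suc.hyps(1) by (rule quotient_dim_right_subspace)
  have "X \<inter> P \<subseteq> Y"
    using quotient_dim_Suc.prems subset_plus_left[OF right_subspace_line, of X x] by blast
  then have IH: "quotient_dim (Y + P) (X + P) n"
    by (rule quotient_dim_Suc.IH)
  have "x \<notin> X + P"
  proof
    assume "x \<in> X + P"
    then obtain y p where y: "y \<in> X" "p \<in> P" "x = y + p"
      by (auto elim: set_plus_elim)
    have "p = - y + x *\<^sub>Q 1"
      using y by (simp add: scaleQ_one)
    then have "p \<in> X + right_line x"
      using right_subspace_uminus[OF X y(1)] plus_line_iff by blast
    then show False
      using quotient_dim_Suc.prems quotient_dim_Suc.hyps(2) y X YX
      by (auto simp: right_subspace_add subset_iff)
  qed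
  from quotient_dim.quotient_dim_Suc[OF IH this] show ?case
    by (simp add: add_ac)
qed

text \<open>
  The other half: intersecting the chain with \<open>N\<close> keeps all steps proper, because each new
  vector can be changed modulo \<open>Y\<close> into one that lies in \<open>N\<close>.
\<close>

lemma quotient_dim_Int:
  assumes "quotient_dim Y X n" and N: "right_subspace N" and "X \<subseteq> Y + N"
  shows "quotient_dim (Y \<inter> N) (X \<inter> N) n"
  using assms(1,3)
proof induction
  case quotient_dim_0
  then show ?case
    using N by (simp add: quotient_dim.quotient_dim_0 right_subspace_Int)
next
  case (quotient_dim_Suc X n x)
  note X = quotient_dim_right_subspace(2)[OF quotient_dim_Suc.hyps(1)]
  have YX: "Y \<subseteq> X"
    using quotient_dim_Suc.hyps(1) by (rule quotient_dim_right_subspace)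
  have "X \<subseteq> Y + N"
    using quotient_dim_Suc.prems subset_plus_left[OF right_subspace_line, of X x] by blast
  then have IH: "quotient_dim (Y \<inter> N) (X \<inter> N) n"
    by (rule quotient_dim_Suc.IH)
  have "x \<in> Y + N"
    using quotient_dim_Suc.prems mem_right_line[of x] subset_plus_right[OF X, of "right_line x"] by blast
  then obtain y v where v: "y \<in> Y" "v \<in> N" "x = y + v"
    by (auto elim: set_plus_elim)
  \<comment> \<open>replace the new vector \<open>x\<close> of the chain by its component \<open>v\<close> in \<open>N\<close>\<close>
  have "v \<notin> X"
    using v YX quotient_dim_Suc.hyps(2) right_subspace_add[OF X] by blast
  have "v = - y + x *\<^sub>Q 1" "- y \<in> X"
    using v YX right_subspace_uminus[OF X] by (auto simp: scaleQ_one)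
  then have "v \<in> X + right_line x"
    using plus_line_iff by blast
  then have eq: "X + right_line x = X + right_line v"
    using plus_line_eq[OF X _ \<open>v \<notin> X\<close>] by simp
  have "(X + right_line v) \<inter> N = X \<inter> N + right_line v"
  proof (rule antisym)
    show "X \<inter> N + right_line v \<subseteq> (X + right_line v) \<inter> N"
    proof -
      have "X \<inter> N + right_line v \<subseteq> X + right_line v"
        by (rule set_plus_mono2) auto
      moreover have "X \<inter> N + right_line v \<subseteq> N"
        by (intro plus_subset N line_subset v) auto
      ultimately show ?thesis
        by blast
    qed
    show "(X + right_line v) \<inter> N \<subseteq> X \<inter> N + right_line v"
    proof
      fix w assume w: "w \<in> (X + right_line v) \<inter> N"
      then obtain a q where a: "a \<in> X" "w = a + v *\<^sub>Q q"
        by (auto simp: plus_line_iff)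
      then have "a = w - v *\<^sub>Q q"
        by simp
      then have "a \<in> N"
        using w v(2) N by (simp add: right_subspace_diff right_subspace_scaleQ)
      then show "w \<in> X \<inter> N + right_line v"
        using a by (auto simp: plus_line_iff)
    qed
  qed
  moreover have "quotient_dim (Y \<inter> N) (X \<inter> N + right_line v) (Suc n)"
    using IH \<open>v \<notin> X\<close> by (auto intro: quotient_dim.quotient_dim_Suc)
  ultimately show ?case
    using eq by simp
qed

text \<open>
  \<open>dim (W / Y) = dim (X / Y) + dim (W / X)\<close>, including the finiteness of the summands. A step of
  the chain from \<open>W\<close> to \<open>W + xH\<close> contributes to \<open>X / Y\<close> if it can be made with a vector
  \<open>x\<close> of \<open>X\<close>, and to the other quotient otherwise.
\<close>

lemma quotient_dim_split:
  assumes "quotient_dim Y W n" and "right_subspace X" "Y \<subseteq> X" "X \<subseteq> W"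
  shows "\<exists>a b. quotient_dim Y X a \<and> quotient_dim X W b \<and> n = a + b"
  using assms
proof (induction arbitrary: X)
  case quotient_dim_0
  then have "X = Y"
    by blast
  moreover have "quotient_dim Y Y 0"
    using quotient_dim_0.hyps by (rule quotient_dim.quotient_dim_0)
  ultimately show ?case
    by auto
next
  case (quotient_dim_Suc W n w)
  note W = quotient_dim_right_subspace(2)[OF quotient_dim_Suc.hyps(1)]
  have YW: "Y \<subseteq> W"
    using quotient_dim_Suc.hyps(1) by (rule quotient_dim_right_subspace)
  have "\<exists>a b. quotient_dim Y (X \<inter> W) a \<and> quotient_dim (X \<inter> W) W b \<and> n = a + b"
    using quotient_dim_Suc.IH[of "X \<inter> W"] quotient_dim_Suc.prems W YW right_subspace_Int by blast
  then obtain a b where ab: "quotient_dim Y (X \<inter> W) a" "quotient_dim (X \<inter> W) W b" "n = a + b"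
    by blast
  show ?case
  proof (cases "X \<subseteq> W")
    case True
    then have "quotient_dim Y X a" "quotient_dim X (W + right_line w) (Suc b)"
      using ab quotient_dim_Suc.hyps(2) by (auto simp: Int_absorb2 intro: quotient_dim.quotient_dim_Suc)
    then show ?thesis
      using ab(3) by (metis add_Suc_right)
  next
    case False
    then obtain x where x: "x \<in> X" "x \<notin> W"
      by blast
    have xW: "x \<in> W + right_line w"
      using x(1) quotient_dim_Suc.prems by blast
    \<comment> \<open>\<open>x\<close> may replace \<open>w\<close> as the last vector of the chain, and it also leads from \<open>X \<inter> W\<close> to \<open>X\<close>\<close>
    have eq: "W + right_line x = W + right_line w"
      by (rule plus_line_eq[OF W xW x(2)])
    have X: "X \<inter> W + right_line x = X"
    proof (rule antisym)
      show "X \<inter> W + right_line x \<subseteq> X"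
        by (intro plus_subset line_subset quotient_dim_Suc.prems x) auto
      show "X \<subseteq> X \<inter> W + right_line x"
      proof
        fix z assume z: "z \<in> X"
        then have "z \<in> W + right_line x"
          using eq quotient_dim_Suc.prems by blast
        then obtain y q where y: "y \<in> W" "z = y + x *\<^sub>Q q"
          by (auto simp: plus_line_iff)
        then have "y = z - x *\<^sub>Q q"
          by simp
        then have "y \<in> X"
          using z x(1) quotient_dim_Suc.prems(1) by (simp add: right_subspace_diff right_subspace_scaleQ)
        then show "z \<in> X \<inter> W + right_line x"
          using y by (auto simp: plus_line_iff)
      qed
    qed
    have "quotient_dim Y (X \<inter> W + right_line x) (Suc a)"
      using ab(1) x(2) by (auto intro: quotient_dim.quotient_dim_Suc)
    moreover have "W \<inter> right_line x \<subseteq> X \<inter> W"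
      using line_subset[OF quotient_dim_Suc.prems(1) x(1)] by blast
    then have "quotient_dim (X \<inter> W + right_line x) (W + right_line x) b"
      by (rule quotient_dim_plus[OF ab(2) right_subspace_line])
    ultimately show ?thesis
      using ab(3) X eq by (metis add_Suc)
  qed
qed

lemma quotient_dim_line:
  assumes "quotient_dim X (X + right_line x) b" "x \<notin> X"
  shows "b = 1"
  using assms(1)
proof cases
  case quotient_dim_0
  then have "x \<in> X"
    using subset_plus_right[of X "right_line x"] mem_right_line[of x] by blast
  then show ?thesis
    using assms(2) by blast
next
  case (quotient_dim_Suc W n w)
  note W = quotient_dim_right_subspace[OF quotient_dim_Suc(3)]
  have "W = X"
  proof (rule ccontr)
    assume "W \<noteq> X"
    then obtain z where z: "z \<in> W" "z \<notin> X"
      using W(3) by blast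
    then have "z \<in> X + right_line x"
      using quotient_dim_Suc(1) subset_plus_left[OF right_subspace_line, of W w] by blast
    then have "X + right_line x = X + right_line z"
      using plus_line_eq[OF W(1) _ z(2)] by blast
    also have "\<dots> \<subseteq> W"
      by (intro plus_subset line_subset W z)
    finally have "w \<in> W"
      using quotient_dim_Suc(1) mem_right_line[of w] subset_plus_right[OF W(2), of "right_line w"] by blast
    then show False
      using quotient_dim_Suc by blast
  qed
  then have "n = 0"
    using quotient_dim_Suc(3) quotient_dim_self by simp
  then show ?thesis
    using quotient_dim_Suc(2) by simp
qed

text \<open>
  The counterpart of Steinitz' theorem: split the second chain at the last but one member of the
  first chain, and compare the two parts with the first chain by induction and by
  \<open>quotient_dim_line\<close>.
\<close>

lemma quotient_dim_unique:
  assumes "quotient_dim Y W n" "quotient_dim Y W m"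
  shows "n = m"
  using assms
proof (induction arbitrary: m)
  case quotient_dim_0
  then show ?case
    by (simp add: quotient_dim_self)
next
  case (quotient_dim_Suc W n w)
  note W = quotient_dim_right_subspace[OF quotient_dim_Suc.hyps(1)]
  obtain a b where ab: "quotient_dim Y W a" "quotient_dim W (W + right_line w) b" "m = a + b"
    using quotient_dim_split[OF quotient_dim_Suc.prems W(2,3)] subset_plus_left[OF right_subspace_line, of W w]
    by blast
  have "a = n"
    using quotient_dim_Suc.IH[OF ab(1)] by simp
  moreover have "b = 1"
    by (rule quotient_dim_line[OF ab(2) quotient_dim_Suc.hyps(2)])
  ultimately show ?case
    using ab(3) by simp
qed

text \<open>
  The vectors adjoined along a chain from \<open>Y\<close> span a complement of \<open>Y\<close>, for the same chain
  can be built on \<open>{0}\<close>.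
\<close>

lemma quotient_dim_complement:
  assumes "quotient_dim Y X n"
  shows "\<exists>Z. quotient_dim {0} Z n \<and> Y \<inter> Z = {0} \<and> Y + Z = X"
  using assms
proof induction
  case quotient_dim_0
  then show ?case
    by (intro exI[of _ "{0}"])
      (auto simp: right_subspace_zero right_subspace_0 set_plus_def intro: quotient_dim.quotient_dim_0)
next
  case (quotient_dim_Suc X n x)
  note YX = quotient_dim_right_subspace[OF quotient_dim_Suc.hyps(1)]
  obtain Z where Z: "quotient_dim {0} Z n" "Y \<inter> Z = {0}" "Y + Z = X"
    using quotient_dim_Suc.IH by blast
  note Z' = quotient_dim_right_subspace(2)[OF Z(1)]
  have ZX: "Z \<subseteq> X"
    using Z(3) subset_plus_right[OF YX(1)] by blast
  have "Y \<inter> (Z + right_line x) \<subseteq> {0}"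
  proof
    fix y assume y: "y \<in> Y \<inter> (Z + right_line x)"
    then obtain z q where z: "z \<in> Z" "y = z + x *\<^sub>Q q"
      by (auto simp: plus_line_iff)
    have "y \<in> Z"
    proof (rule ccontr)
      assume "y \<notin> Z"
      then have "x \<in> Z + right_line y"
        using mem_line_exchange[OF Z'] y by blast
      also have "\<dots> \<subseteq> X"
        using y YX by (intro plus_subset line_subset ZX) auto
      finally show False
        using quotient_dim_Suc.hyps(2) by blast
    qed
    then show "y \<in> {0}"
      using y Z(2) by blast
  qed
  then have "Y \<inter> (Z + right_line x) = {0}"
    using right_subspace_0[OF YX(1)] right_subspace_0[OF right_subspace_plus[OF Z' right_subspace_line]]
    by blast
  moreover have "quotient_dim {0} (Z + right_line x) (Suc n)"
    using Z(1) ZX quotient_dim_Suc.hyps(2) by (auto intro: quotient_dim.quotient_dim_Suc)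
  moreover have "Y + (Z + right_line x) = X + right_line x"
    using Z(3) by (simp flip: add.assoc)
  ultimately show ?case
    by blast
qed

lemma quotient_dim_of_complement:
  assumes "right_subspace Y" "quotient_dim {0} Z n" "Y \<inter> Z = {0}"
  shows "quotient_dim Y (Y + Z) n"
  using quotient_dim_plus[OF assms(2,1)] assms(3) by (simp add: Int_commute add.commute flip: set_zero)

section \<open>Quotient dimensions under linear maps\<close>

text \<open>
  The algebraic part of \<^const>\<open>bounded_right_linear\<close>, which is all that dimensions depend on.
\<close>

definition right_linear :: "('v::right_qhilbert \<Rightarrow> 'u::right_qhilbert) \<Rightarrow> bool" where
  "right_linear f \<longleftrightarrow> (\<forall>x y. f (x + y) = f x + f y) \<and> (\<forall>x q. f (x *\<^sub>Q q) = f x *\<^sub>Q q)"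

lemma
  assumes "right_linear f"
  shows right_linear_add: "f (x + y) = f x + f y"
    and right_linear_scaleQ: "f (x *\<^sub>Q q) = f x *\<^sub>Q q"
    and right_linear_0: "f 0 = 0"
    and right_linear_diff: "f (x - y) = f x - f y"
proof -
  show a: "f (x + y) = f x + f y" and "f (x *\<^sub>Q q) = f x *\<^sub>Q q" for x y q
    using assms by (auto simp: right_linear_def)
  show "f 0 = 0"
    using a[of 0 0] by simp
  show "f (x - y) = f x - f y"
    using a[of "x - y" y] by simp
qed

lemma right_subspace_image:
  assumes f: "right_linear f" and X: "right_subspace X"
  shows "right_subspace (f ` X)"
proof (rule right_subspaceI)
  show "0 \<in> f ` X"
    using right_linear_0[OF f] right_subspace_0[OF X] by (metis imageI)
  show "a + b \<in> f ` X" if "a \<in> f ` X" "b \<in> f ` X" for a b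
    using that right_subspace_add[OF X] by (auto simp flip: right_linear_add[OF f])
  show "a *\<^sub>Q q \<in> f ` X" if "a \<in> f ` X" for a q
    using that right_subspace_scaleQ[OF X] by (auto simp flip: right_linear_scaleQ[OF f])
qed

lemma right_subspace_vimage_zero: "right_linear f \<Longrightarrow> right_subspace {x. f x = 0}"
  by (rule right_subspaceI)
    (auto simp: right_linear_0 right_linear_add right_linear_scaleQ scaleQ_zero_left)

lemma quotient_dim_image:
  assumes f: "right_linear f" and "quotient_dim Y X n" and ker: "{x. f x = 0} \<subseteq> Y"
  shows "quotient_dim (f ` Y) (f ` X) n"
  using assms(2)
proof induction
  case quotient_dim_0
  then show ?case
    using f by (simp add: quotient_dim.quotient_dim_0 right_subspace_image)
next
  case (quotient_dim_Suc X n x)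
  note YX = quotient_dim_right_subspace[OF quotient_dim_Suc.hyps(1)]
  have "f x \<notin> f ` X"
  proof
    assume "f x \<in> f ` X"
    then obtain y where y: "y \<in> X" "f x = f y"
      by blast
    then have "f (x - y) = 0"
      using f by (simp add: right_linear_diff)
    then have "x - y \<in> X"
      using ker YX(3) by blast
    then show False
      using right_subspace_add[OF YX(2) _ y(1)] quotient_dim_Suc.hyps(2) by fastforce
  qed
  moreover have "f ` (X + right_line x) = f ` X + right_line (f x)"
  proof (intro set_eqI iffI)
    fix w assume "w \<in> f ` (X + right_line x)"
    then obtain y q where "y \<in> X" "w = f (y + x *\<^sub>Q q)"
      by (auto simp: plus_line_iff)
    then have "w = f y + f x *\<^sub>Q q" "f y \<in> f ` X"
      using f by (simp_all add: right_linear_add right_linear_scaleQ)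
    then show "w \<in> f ` X + right_line (f x)"
      unfolding plus_line_iff by blast
  next
    fix w assume "w \<in> f ` X + right_line (f x)"
    then obtain y q where y: "y \<in> X" "w = f y + f x *\<^sub>Q q"
      by (auto simp: plus_line_iff)
    then have "w = f (y + x *\<^sub>Q q)"
      using f by (simp add: right_linear_add right_linear_scaleQ)
    moreover have "y + x *\<^sub>Q q \<in> X + right_line x"
      using y plus_line_iff by blast
    ultimately show "w \<in> f ` (X + right_line x)"
      by blast
  qed
  ultimately show ?case
    using quotient_dim_Suc.IH by (simp add: quotient_dim.quotient_dim_Suc)
qed

text \<open>
  The index of \<open>f\<close> can be read off from any subspace \<open>M\<close> of finite codimension on which \<open>f\<close> is
  injective, if \<open>f M\<close> has finite codimension as well: the index is \<open>dim (V / M) - dim (U / f M)\<close>.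
  In fact \<open>f V / f M\<close> is isomorphic to \<open>V / (M + ker f)\<close>; with \<open>r\<close> for their dimension,
  \<open>dim (V / M) = dim (ker f) + r\<close> and \<open>dim (U / f M) = r + dim (U / f V)\<close>.
\<close>

lemma quotient_dim_ker_coker:
  fixes f :: "'v::right_qhilbert \<Rightarrow> 'u::right_qhilbert"
  assumes f: "right_linear f" and M: "quotient_dim M UNIV n" and fM: "quotient_dim (f ` M) UNIV m"
    and inj: "M \<inter> {x. f x = 0} = {0}"
  shows "\<exists>k l. quotient_dim {0} {x. f x = 0} k \<and> quotient_dim (range f) UNIV l \<and> k + m = n + l"
proof -
  let ?K = "{x. f x = 0}"
  note MS = quotient_dim_right_subspace(1)[OF M]
  note K = right_subspace_vimage_zero[OF f]
  obtain k r where k: "quotient_dim M (M + ?K) k" "quotient_dim (M + ?K) UNIV r" "n = k + r"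
    using quotient_dim_split[OF M right_subspace_plus[OF MS K]] subset_plus_left[OF K, of M] by blast
  have "quotient_dim (M \<inter> ?K) ((M + ?K) \<inter> ?K) k"
    by (rule quotient_dim_Int[OF k(1) K]) simp
  moreover have "(M + ?K) \<inter> ?K = ?K"
    using subset_plus_right[OF MS, of ?K] by blast
  ultimately have "quotient_dim {0} ?K k"
    using inj by simp
  moreover have "quotient_dim (f ` (M + ?K)) (range f) r"
    by (rule quotient_dim_image[OF f k(2) subset_plus_right[OF MS]])
  moreover have "f ` (M + ?K) = f ` M"
  proof (rule antisym)
    show "f ` (M + ?K) \<subseteq> f ` M"
      using f by (auto elim!: set_plus_elim simp: right_linear_add)
  qed (rule image_mono[OF subset_plus_left[OF K]])
  moreover obtain r' l where "quotient_dim (f ` M) (range f) r'" "quotient_dim (range f) UNIV l" "m = r' + l"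
    using quotient_dim_split[OF fM right_subspace_image[OF f right_subspace_UNIV]] by blast
  ultimately show ?thesis
    using k(3) quotient_dim_unique[of "f ` M" "range f" r r'] by (intro exI[of _ k] exI[of _ l]) auto
qed

section \<open>Bases of kernels and cokernels\<close>

definition right_span :: "'a::right_qhilbert set \<Rightarrow> 'a set" where
  "right_span S = right_subspace hull S"

lemma right_subspace_span: "right_subspace (right_span S)"
  unfolding right_span_def by (rule hull_in) (simp add: right_subspace_def)

lemma subset_right_span: "S \<subseteq> right_span S"
  unfolding right_span_def by (rule hull_subset)

lemma right_span_minimal: "S \<subseteq> X \<Longrightarrow> right_subspace X \<Longrightarrow> right_span S \<subseteq> X"
  unfolding right_span_def by (rule hull_minimal)

lemma right_span_mono: "S \<subseteq> T \<Longrightarrow> right_span S \<subseteq> right_span T"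
  unfolding right_span_def by (rule hull_mono)

lemma right_span_subspace: "right_subspace X \<Longrightarrow> right_span X = X"
  unfolding right_span_def by (rule hull_same)

lemma right_span_insert: "right_span (insert x S) = right_span S + right_line x"
proof (rule antisym)
  show "right_span (insert x S) \<subseteq> right_span S + right_line x"
  proof (rule right_span_minimal)
    have "x \<in> right_span S + right_line x"
      using subset_plus_right[OF right_subspace_span, of "right_line x" S] mem_right_line[of x] by blast
    moreover have "S \<subseteq> right_span S + right_line x"
      using subset_plus_left[OF right_subspace_line, of "right_span S" x] subset_right_span[of S] by blast
    ultimately show "insert x S \<subseteq> right_span S + right_line x"
      by blast
  qed (intro right_subspace_plus right_subspace_span right_subspace_line)
  have "x \<in> right_span (insert x S)"
    using subset_right_span by blast
  then show "right_span S + right_line x \<subseteq> right_span (insert x S)"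
    by (intro plus_subset line_subset right_subspace_span right_span_mono) auto
qed

text \<open>
  The set \<open>S\<close> consists of representatives of a finite basis of \<open>X / Y\<close>.
\<close>

definition quotient_basis :: "'a::right_qhilbert set \<Rightarrow> 'a set \<Rightarrow> 'a set \<Rightarrow> bool" where
  "quotient_basis Y X S \<longleftrightarrow>
     finite S \<and> right_span (Y \<union> S) = X \<and> (\<forall>s\<in>S. s \<notin> right_span (Y \<union> (S - {s})))"

lemma quotient_dim_span:
  assumes Y: "right_subspace Y" and "finite S" and "\<forall>s\<in>S. s \<notin> right_span (Y \<union> (S - {s}))"
  shows "quotient_dim Y (right_span (Y \<union> S)) (card S)"
  using assms(2,3)
proof (induction S)
  case empty
  then show ?case
    using Y by (simp add: right_span_subspace quotient_dim_0)
next
  case (insert x S)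
  have "\<forall>s\<in>S. s \<notin> right_span (Y \<union> (S - {s}))"
    using insert.prems right_span_mono[of "Y \<union> (S - {s})" "Y \<union> (insert x S - {s})" for s] by blast
  then have "quotient_dim Y (right_span (Y \<union> S)) (card S)"
    by (rule insert.IH)
  moreover have "x \<notin> right_span (Y \<union> S)"
    using insert.prems insert.hyps(2) by simp
  ultimately show ?case
    using insert.hyps by (simp add: right_span_insert quotient_dim_Suc)
qed

text \<open>
  The vectors adjoined along a chain form a basis of the quotient: by exchange, a vector outside
  the span of an independent set can be added to it.
\<close>

lemma quotient_dim_imp_basis:
  assumes "quotient_dim Y X n"
  shows "\<exists>S. quotient_basis Y X S \<and> card S = n"
  using assms
proof induction
  case quotient_dim_0
  then show ?case
    by (intro exI[of _ "{}"]) (simp add: quotient_basis_def right_span_subspace)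
next
  case (quotient_dim_Suc X n x)
  then obtain S where S: "finite S" "right_span (Y \<union> S) = X" "card S = n"
      "\<And>s. s \<in> S \<Longrightarrow> s \<notin> right_span (Y \<union> (S - {s}))"
    by (auto simp: quotient_basis_def)
  have "x \<notin> S"
    using S(2) quotient_dim_Suc.hyps(2) subset_right_span by blast
  have "s \<notin> right_span (Y \<union> (insert x S - {s}))" if "s \<in> insert x S" for s
  proof (cases "s = x")
    case True
    then show ?thesis
      using S(2) \<open>x \<notin> S\<close> quotient_dim_Suc.hyps(2) by simp
  next
    case False
    let ?T = "Y \<union> (S - {s})"
    have s: "s \<in> S"
      using that False by blast
    have "s \<notin> right_span ?T + right_line x"
    proof
      assume "s \<in> right_span ?T + right_line x"
      then have "x \<in> right_span ?T + right_line s"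
        by (rule mem_line_exchange[OF right_subspace_span]) (rule S(4)[OF s])
      moreover have "insert s ?T = Y \<union> S"
        using s by blast
      ultimately show False
        using S(2) quotient_dim_Suc.hyps(2) by (simp flip: right_span_insert)
    qed
    moreover have "Y \<union> (insert x S - {s}) = insert x ?T"
      using False by blast
    ultimately show ?thesis
      by (simp add: right_span_insert)
  qed
  then have "quotient_basis Y (X + right_line x) (insert x S)"
    using S by (simp add: quotient_basis_def right_span_insert)
  then show ?case
    using S \<open>x \<notin> S\<close> by (intro exI[of _ "insert x S"]) simp
qed

lemma quotient_dim_iff_basis:
  assumes "right_subspace Y"
  shows "quotient_dim Y X n \<longleftrightarrow> (\<exists>S. quotient_basis Y X S \<and> card S = n)"
  using quotient_dim_imp_basis quotient_dim_span[OF assms] by (auto simp: quotient_basis_def)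

text \<open>
  The value of \<^const>\<open>qdim\<close> is the size of an arbitrarily chosen basis; uniqueness of the
  dimension of \<open>X / Y\<close> makes it independent of that choice.
\<close>

lemma
  assumes "\<And>n. quotient_dim Y X n \<longleftrightarrow> (\<exists>B. finite B \<and> qbasis W B \<and> card B = n)"
  shows finite_qdim_iff_quotient_dim: "finite_qdim W \<longleftrightarrow> (\<exists>n. quotient_dim Y X n)"
    and qdim_eq_quotient_dim: "quotient_dim Y X n \<Longrightarrow> qdim W = n"
proof -
  show "finite_qdim W \<longleftrightarrow> (\<exists>n. quotient_dim Y X n)"
    unfolding finite_qdim_def assms by blast
  assume n: "quotient_dim Y X n"
  let ?B = "SOME B. finite B \<and> qbasis W B"
  have "\<exists>B. finite B \<and> qbasis W B"
    using n assms by blast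
  then have "finite ?B \<and> qbasis W ?B"
    by (rule someI_ex)
  then have "quotient_dim Y X (qdim W)"
    unfolding assms qdim_def by blast
  then show "qdim W = n"
    using n by (rule quotient_dim_unique)
qed

lemma qspan_ker_qspace:
  assumes f: "right_linear f" and S: "S \<subseteq> {x. f x = 0}"
  shows "qspan (ker_qspace f) S = right_span S"
proof -
  let ?K = "{x. f x = 0}"
  have sub: "qsubspace (ker_qspace f) = (\<lambda>T. T \<subseteq> ?K \<and> right_subspace T)"
    by (auto simp: fun_eq_iff qsubspace_def ker_qspace_def right_subspace_def)
  have "right_span S \<subseteq> ?K"
    using right_span_minimal[OF S right_subspace_vimage_zero[OF f]] .
  then have "qsubspace (ker_qspace f) hull S \<subseteq> right_span S"
    by (intro hull_minimal subset_right_span) (simp add: sub right_subspace_span)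
  moreover have "right_span S \<subseteq> qsubspace (ker_qspace f) hull S"
    unfolding right_span_def sub by (rule hull_antimono) auto
  ultimately show ?thesis
    by (simp add: qspan_def)
qed

lemma quotient_dim_ker_iff_qbasis:
  assumes f: "right_linear f"
  shows "quotient_dim {0} {x. f x = 0} n \<longleftrightarrow>
    (\<exists>B. finite B \<and> qbasis (ker_qspace f) B \<and> card B = n)"
proof -
  let ?K = "{x. f x = 0}"
  have zero: "right_span ({0} \<union> S) = right_span S" for S :: "'a set"
    by (intro antisym right_span_minimal right_subspace_span right_span_mono)
      (auto simp: right_subspace_0[OF right_subspace_span] intro: subsetD[OF subset_right_span])
  have "quotient_basis {0} ?K B \<longleftrightarrow> finite B \<and> qbasis (ker_qspace f) B" for B
  proof (cases "B \<subseteq> ?K")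
    case True
    then have "qspan (ker_qspace f) (B - {b}) = right_span (B - {b})" for b
      by (intro qspan_ker_qspace[OF f]) blast
    then show ?thesis
      using True qspan_ker_qspace[OF f True]
      unfolding quotient_basis_def qbasis_def zero by (auto simp: ker_qspace_def)
  next
    case False
    then have "\<not> quotient_basis {0} ?K B"
      using subset_right_span[of B] unfolding quotient_basis_def zero by blast
    moreover have "\<not> qbasis (ker_qspace f) B"
      using False by (simp add: qbasis_def ker_qspace_def)
    ultimately show ?thesis
      by simp
  qed
  then show ?thesis
    by (simp add: quotient_dim_iff_basis right_subspace_zero conj_assoc)
qed

text \<open>
  A subspace above \<open>R\<close> is determined by the cosets of \<open>R\<close> in it, so that membership in spans
  of the quotient can be decided on representatives.
\<close>

lemma coset_mem_iff:
  assumes R: "right_subspace R" and T: "right_subspace T" "R \<subseteq> T"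
  shows "u +o R \<in> (\<lambda>u. u +o R) ` T \<longleftrightarrow> u \<in> T"
proof
  assume "u +o R \<in> (\<lambda>u. u +o R) ` T"
  then obtain t where t: "t \<in> T" "u +o R = t +o R"
    by blast
  have "u + 0 \<in> u +o R"
    using right_subspace_0[OF R] by (rule set_plus_intro2)
  then obtain r where "r \<in> R" "u = t + r"
    unfolding t(2) by (auto simp: elt_set_plus_def)
  then show "u \<in> T"
    using t(1) T right_subspace_add by blast
qed blast

lemma qspan_quotient_qspace:
  assumes R: "right_subspace R"
  shows "qspan (quotient_qspace R) ((\<lambda>u. u +o R) ` S) = (\<lambda>u. u +o R) ` right_span (R \<union> S)"
proof (rule antisym)
  let ?p = "\<lambda>u. u +o R" and ?W = "quotient_qspace R" and ?X = "right_span (R \<union> S)"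
  note RI = right_subspace_0[OF R] right_subspace_add[OF R] right_subspace_scaleQ[OF R]
  note add = quotient_qspace_add[OF RI] and scale = quotient_qspace_scale[OF RI]
  have W: "qcarrier ?W = range ?p" "qadd ?W = (+)" "qzero ?W = R"
      "qscale ?W = (\<lambda>C q. (\<lambda>u. u *\<^sub>Q q) ` C + R)"
    by (simp_all add: quotient_qspace_def)
  have zero: "?p 0 = R"
    by (simp add: elt_set_plus_def)
  have X: "right_subspace ?X"
    by (rule right_subspace_span)
  have "qsubspace ?W (?p ` ?X)"
    unfolding qsubspace_def W
  proof (intro conjI ballI allI)
    show "R \<in> ?p ` ?X"
      using zero right_subspace_0[OF X] by (metis imageI)
    show "a + b \<in> ?p ` ?X" if "a \<in> ?p ` ?X" "b \<in> ?p ` ?X" for a b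
      using that right_subspace_add[OF X] by (auto simp: add)
    show "(\<lambda>u. u *\<^sub>Q q) ` a + R \<in> ?p ` ?X" if "a \<in> ?p ` ?X" for a q
      using that right_subspace_scaleQ[OF X] by (auto simp: scale)
  qed blast
  moreover have "?p ` S \<subseteq> ?p ` ?X"
    using subset_right_span[of "R \<union> S"] by blast
  ultimately show "qspan ?W (?p ` S) \<subseteq> ?p ` ?X"
    unfolding qspan_def by (intro hull_minimal)
  have "?p ` ?X \<subseteq> T" if T: "qsubspace ?W T" "?p ` S \<subseteq> T" for T
  proof -
    note T' = T(1)[unfolded qsubspace_def W]
    have "right_subspace {u. ?p u \<in> T}"
    proof (rule right_subspaceI)
      show "0 \<in> {u. ?p u \<in> T}"
        using T' zero by simp
      show "x + y \<in> {u. ?p u \<in> T}" if "x \<in> {u. ?p u \<in> T}" "y \<in> {u. ?p u \<in> T}" for x y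
        using that T' by (simp flip: add)
      show "x *\<^sub>Q q \<in> {u. ?p u \<in> T}" if "x \<in> {u. ?p u \<in> T}" for x q
        using that T' by (simp flip: scale)
    qed
    moreover have "R \<union> S \<subseteq> {u. ?p u \<in> T}"
    proof -
      have "?p r = R" if "r \<in> R" for r
      proof -
        have "?p r \<subseteq> R"
          using that RI(2) by (auto simp: elt_set_plus_def)
        moreover have "x \<in> ?p r" if "x \<in> R" for x
          using right_subspace_diff[OF R that \<open>r \<in> R\<close>] by (auto simp: elt_set_plus_def intro!: bexI[of _ "x - r"])
        ultimately show ?thesis
          by blast
      qed
      then show ?thesis
        using T' T(2) by auto
    qed
    ultimately have "?X \<subseteq> {u. ?p u \<in> T}"
      by (intro right_span_minimal)
    then show ?thesis
      by blast
  qed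
  then show "?p ` ?X \<subseteq> qspan ?W (?p ` S)"
    unfolding qspan_def hull_def by blast
qed

text \<open>
  Injectivity of the projection on \<open>S\<close> has to be part of the left-hand side, as a basis of the
  quotient is a set of cosets and does not notice repeated representatives.
\<close>

lemma qbasis_quotient_qspace_iff:
  assumes R: "right_subspace R" and S: "finite S"
  shows "inj_on (\<lambda>u. u +o R) S \<and> qbasis (quotient_qspace R) ((\<lambda>u. u +o R) ` S) \<longleftrightarrow>
    quotient_basis R UNIV S"
proof -
  let ?p = "\<lambda>u. u +o R" and ?W = "quotient_qspace R"
  have mem: "?p u \<in> ?p ` right_span (R \<union> T) \<longleftrightarrow> u \<in> right_span (R \<union> T)" for u T
    by (intro coset_mem_iff R right_subspace_span order_trans[OF _ subset_right_span]) blast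
  have span: "qspan ?W (?p ` S) = qcarrier ?W \<longleftrightarrow> right_span (R \<union> S) = UNIV"
  proof -
    have "qspan ?W (?p ` S) = qcarrier ?W \<longleftrightarrow> (\<forall>u. ?p u \<in> ?p ` right_span (R \<union> S))"
      unfolding qspan_quotient_qspace[OF R] by (auto simp: quotient_qspace_def)
    then show ?thesis
      unfolding mem by blast
  qed
  have indep: "?p s \<in> qspan ?W (?p ` S - {?p s}) \<longleftrightarrow> s \<in> right_span (R \<union> (S - {s}))"
    if "inj_on ?p S" "s \<in> S" for s
  proof -
    have "?p ` S - {?p s} = ?p ` (S - {s})"
      using that by (auto simp: inj_on_def)
    then show ?thesis
      by (simp only: qspan_quotient_qspace[OF R] mem)
  qed
  have inj: "inj_on ?p S" if "\<forall>s\<in>S. s \<notin> right_span (R \<union> (S - {s}))"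
  proof (rule inj_onI, rule ccontr)
    fix s t assume st: "s \<in> S" "t \<in> S" "?p s = ?p t" "s \<noteq> t"
    then have "?p s \<in> ?p ` right_span (R \<union> (S - {s}))"
      using subset_right_span[of "R \<union> (S - {s})"] by blast
    then show False
      using that st(1) by (simp add: mem)
  qed
  have sub: "?p ` S \<subseteq> qcarrier ?W"
    by (auto simp: quotient_qspace_def)
  show ?thesis
  proof (cases "inj_on ?p S")
    case True
    then show ?thesis
      using S sub span by (auto simp: qbasis_def quotient_basis_def indep)
  next
    case False
    then show ?thesis
      using inj by (auto simp: quotient_basis_def)
  qed
qed

lemma quotient_dim_coset_iff_qbasis:
  assumes R: "right_subspace R"
  shows "quotient_dim R UNIV n \<longleftrightarrow>
    (\<exists>B. finite B \<and> qbasis (quotient_qspace R) B \<and> card B = n)"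
proof
  let ?p = "\<lambda>u. u +o R"
  assume "quotient_dim R UNIV n"
  then obtain S where S: "quotient_basis R UNIV S" "card S = n"
    using quotient_dim_imp_basis by blast
  have "finite S"
    using S(1) by (simp add: quotient_basis_def)
  then have "finite (?p ` S) \<and> qbasis (quotient_qspace R) (?p ` S) \<and> card (?p ` S) = n"
    using qbasis_quotient_qspace_iff[OF R \<open>finite S\<close>] S by (auto simp: card_image)
  then show "\<exists>B. finite B \<and> qbasis (quotient_qspace R) B \<and> card B = n"
    by blast
next
  let ?p = "\<lambda>u. u +o R"
  assume "\<exists>B. finite B \<and> qbasis (quotient_qspace R) B \<and> card B = n"
  then obtain B where B: "finite B" "qbasis (quotient_qspace R) B" "card B = n"
    by blast
  then have "B \<subseteq> range ?p"
    by (simp add: qbasis_def quotient_qspace_def)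
  then obtain S where S: "inj_on ?p S" "B = ?p ` S"
    by (meson subset_image_inj)
  then have "finite S" "card S = n"
    using B by (auto simp: card_image dest: finite_imageD)
  then show "quotient_dim R UNIV n"
    using qbasis_quotient_qspace_iff[OF R \<open>finite S\<close>] S B quotient_dim_iff_basis[OF R] by blast
qed

section \<open>Bounded projections onto finite-dimensional subspaces\<close>

lemma qcnj_add: "qcnj (p + q) = qcnj p + qcnj q"
  by (simp add: qcnj_def plus_quat_def)

lemma qinner_add_left: "qinner (x + y) z = qinner x z + qinner y z"
  for x y z :: "'a::right_qhilbert"
  using qinner_add_right[of z x y] by (metis qinner_commute qcnj_add)

text \<open>
  Bessel's inequality for a single unit vector: \<open>v\<close> is the orthogonal sum of its component along
  \<open>e\<close> and a remainder.
\<close>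

lemma norm_scaleQ_qinner_le:
  fixes e v :: "'a::right_qhilbert"
  assumes "norm e = 1"
  shows "norm (e *\<^sub>Q qinner e v) \<le> norm v"
proof -
  define y where "y = e *\<^sub>Q qinner e v"
  define w where "w = v - y"
  have v: "v = w + y"
    by (simp add: w_def)
  have "qinner y z = qcnj (qinner e v) * qinner e z" for z
    by (simp add: y_def qinner_scaleQ_left)
  moreover have "qinner e y = qinner e v"
    using assms by (simp add: y_def qinner_scaleQ_right qinner_self)
  ultimately have "qinner y v = qinner y y"
    by simp
  then have yw: "qinner y w = 0"
    using qinner_add_right[of y w y] by (simp add: v)
  then have wy: "qinner w y = 0"
    using qinner_commute[of y w] by (simp add: qcnj_def zero_quat_def)
  have "qinner v v = qinner w w + qinner y y"
    by (simp add: v qinner_add_left qinner_add_right yw wy)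
  then have "(of_real ((norm v)\<^sup>2) :: quat) = of_real ((norm w)\<^sup>2 + (norm y)\<^sup>2)"
    by (simp add: qinner_self)
  then have "(norm v)\<^sup>2 = (norm w)\<^sup>2 + (norm y)\<^sup>2"
    by (rule of_real_eq_iff[THEN iffD1])
  then show ?thesis
    by (auto simp: y_def[symmetric] intro: power2_le_imp_le)
qed

lemma bounded_linear_scaleQ_qinner:
  fixes e :: "'a::right_qhilbert"
  assumes "norm e = 1"
  shows "bounded_linear (\<lambda>v. e *\<^sub>Q qinner e v)"
proof (rule bounded_linear_intro[where K = 1])
  show "e *\<^sub>Q qinner e (r *\<^sub>R v) = r *\<^sub>R (e *\<^sub>Q qinner e v)" for r and v :: 'a
    by (simp add: qinner_scaleQ_right flip: scaleQ_of_real scaleQ_scaleQ)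
qed (use norm_scaleQ_qinner_le[OF assms] in \<open>auto simp: qinner_add_right scaleQ_add_right\<close>)

text \<open>
  When the line through \<open>x\<close> is added to \<open>Z\<close>, the projection \<open>P\<close> onto \<open>Z\<close> is corrected by the
  component of \<open>v - P v\<close> along a unit vector \<open>e\<close> of the larger space with \<open>P e = 0\<close>, as in the
  Gram-Schmidt process. Boundedness of the projection makes its range closed and its kernel a
  closed complement of the range.
\<close>

lemma finite_dim_projection:
  fixes Z :: "'a::right_qhilbert set"
  assumes "quotient_dim {0} Z n"
  shows "\<exists>P. bounded_linear P \<and> right_linear P \<and> range P \<subseteq> Z \<and> (\<forall>z\<in>Z. P z = z)"
  using assms
proof induction
  case quotient_dim_0
  then show ?case
    by (intro exI[of _ "\<lambda>_. 0"]) (auto simp: right_linear_def scaleQ_zero_left)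
next
  case (quotient_dim_Suc Z n x)
  note Z = quotient_dim_right_subspace(2)[OF quotient_dim_Suc.hyps(1)]
  obtain P where P: "bounded_linear P" "right_linear P" "\<And>x. P x \<in> Z" "\<And>z. z \<in> Z \<Longrightarrow> P z = z"
    using quotient_dim_Suc.IH by blast
  interpret P: bounded_linear P by fact
  have "x - P x \<noteq> 0"
    using P(3)[of x] quotient_dim_Suc.hyps(2) by auto
  define e where "e = (x - P x) /\<^sub>R norm (x - P x)"
  have e: "norm e = 1" "P e = 0"
    using \<open>x - P x \<noteq> 0\<close> P(3,4) by (simp_all add: e_def P.scaleR P.diff)
  have "e \<notin> Z"
    using e P(4) by force
  have "e = - (P x /\<^sub>R norm (x - P x)) + x *\<^sub>Q of_real (inverse (norm (x - P x)))"
    unfolding scaleQ_of_real by (simp add: e_def scaleR_diff_right)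
  moreover have "- (P x /\<^sub>R norm (x - P x)) \<in> Z"
    by (intro right_subspace_uminus right_subspace_scaleR Z P(3))
  ultimately have "e \<in> Z + right_line x"
    unfolding plus_line_iff by blast
  then have eq: "Z + right_line x = Z + right_line e"
    using plus_line_eq[OF Z _ \<open>e \<notin> Z\<close>] by simp
  define Q where "Q v = P v + e *\<^sub>Q qinner e (v - P v)" for v
  have "bounded_linear Q"
    unfolding Q_def
    by (intro bounded_linear_add P(1) bounded_linear_sub bounded_linear_ident
        bounded_linear_compose[OF bounded_linear_scaleQ_qinner[OF e(1)]])
  moreover have "right_linear Q"
    unfolding right_linear_def
  proof (intro conjI allI)
    show "Q (v + w) = Q v + Q w" for v w
      using \<open>bounded_linear Q\<close> by (rule linear_simps)
    show "Q (v *\<^sub>Q q) = Q v *\<^sub>Q q" for v q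
      by (simp add: Q_def right_linear_scaleQ[OF P(2)] qinner_scaleQ_right scaleQ_scaleQ scaleQ_add_left
          flip: scaleQ_diff_left)
  qed
  moreover have "Q v \<in> Z + right_line x" for v
    unfolding eq plus_line_iff Q_def using P(3) by blast
  then have "range Q \<subseteq> Z + right_line x"
    by blast
  moreover have "Q z = z" if z: "z \<in> Z + right_line x" for z
  proof -
    obtain y q where y: "y \<in> Z" "z = y + e *\<^sub>Q q"
      using z unfolding eq plus_line_iff by blast
    have "P z = y"
      using y e(2) P(4) by (simp add: P.add right_linear_scaleQ[OF P(2)] scaleQ_zero_left)
    then show ?thesis
      using y e(1) by (simp add: Q_def qinner_scaleQ_right qinner_self)
  qed
  ultimately show ?case
    by blast
qed

section \<open>Perturbation of bounded bijections\<close>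

text \<open>
  The Baire category part of the open mapping theorem. The closures of the images of the balls of
  integer radius cover the target, so one of them contains a ball around some \<open>y0\<close>. A suitable
  multiple of \<open>y\<close> is the difference of two points of this ball, and scaling back gives
  an approximate preimage of \<open>y\<close> whose norm is controlled by that of \<open>y\<close>.
\<close>

lemma surj_on_subspace_almost_open:
  fixes f :: "'a::banach \<Rightarrow> 'b::banach"
  assumes f: "bounded_linear f" and C: "subspace C" and surj: "f ` C = UNIV"
  shows "\<exists>K>0. \<forall>y. \<exists>x\<in>C. norm x \<le> K * norm y \<and> norm (y - f x) \<le> norm y / 2"
proof -
  interpret f: bounded_linear f by fact
  define D where "D n = closure (f ` (C \<inter> cball 0 (real n)))" for n
  have "\<Union>(range D) = UNIV"
  proof -
    have "y \<in> \<Union>(range D)" for y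
    proof -
      obtain x where x: "x \<in> C" "y = f x"
        using surj by (metis imageE UNIV_I)
      obtain n where "norm x \<le> real n"
        using real_arch_simple by blast
      then have "y \<in> D n"
        unfolding D_def using x by (intro subsetD[OF closure_subset]) auto
      then show ?thesis
        by blast
    qed
    then show ?thesis
      by blast
  qed
  moreover have "\<exists>n. interior (D n) \<noteq> {}"
  proof (rule ccontr)
    assume "\<not> ?thesis"
    then have "euclidean interior_of \<Union>(range D) = {}"
      by (intro Baire_category_alt) (auto simp: completely_metrizable_space_euclidean D_def)
    then show False
      using \<open>\<Union>(range D) = UNIV\<close> by simp
  qed
  then obtain n y0 where "y0 \<in> interior (D n)"
    by blast
  then obtain r where r: "r > 0" "cball y0 r \<subseteq> D n"
    by (meson mem_interior_cball)
  have approx: "\<exists>x\<in>C. norm x \<le> real n \<and> norm (y - f x) < e" if y: "y \<in> D n" and "e > 0" for y e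
  proof -
    have "\<exists>z\<in>f ` (C \<inter> cball 0 (real n)). dist z y < e"
      using y \<open>e > 0\<close> unfolding D_def closure_approachable by blast
    then show ?thesis
      by (auto simp: dist_norm norm_minus_commute)
  qed
  show ?thesis
  proof (intro exI[of _ "2 * (real n + 1) / r"] conjI allI)
    show "2 * (real n + 1) / r > 0"
      using r by simp
    fix y :: 'b
    show "\<exists>x\<in>C. norm x \<le> 2 * (real n + 1) / r * norm y \<and> norm (y - f x) \<le> norm y / 2"
    proof (cases "y = 0")
      case True
      then show ?thesis
        using C by (intro bexI[of _ 0]) (auto simp: f.zero subspace_0)
    next
      case False
      \<comment> \<open>\<open>y0 + t *\<^sub>R y\<close> lies on the boundary of the ball of radius \<open>r\<close> around \<open>y0\<close>\<close>
      define t where "t = r / norm y"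
      have t: "t > 0" "t * norm y = r"
        using False r by (auto simp: t_def)
      have "y0 + t *\<^sub>R y \<in> D n" "y0 \<in> D n"
        using r t by (simp_all add: subset_iff dist_norm)
      then obtain x1 x2 where x: "x1 \<in> C" "norm x1 \<le> real n" "norm (y0 + t *\<^sub>R y - f x1) < r / 4"
          "x2 \<in> C" "norm x2 \<le> real n" "norm (y0 - f x2) < r / 4"
        using approx[of "y0 + t *\<^sub>R y" "r / 4"] approx[of y0 "r / 4"] r(1) by auto
      define x where "x = (1 / t) *\<^sub>R (x1 - x2)"
      have "x \<in> C"
        using x C by (simp add: x_def subspace_scale subspace_diff)
      moreover have "norm x \<le> 2 * (real n + 1) / r * norm y"
      proof -
        have "norm x = norm (x1 - x2) / t"
          using t by (simp add: x_def)
        also have "\<dots> \<le> (2 * (real n + 1)) / t"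
          using x t norm_triangle_ineq4[of x1 x2] by (intro divide_right_mono) auto
        finally show ?thesis
          by (simp add: t_def)
      qed
      moreover have "norm (y - f x) \<le> norm y / 2"
      proof -
        have "y - f x = (1 / t) *\<^sub>R ((y0 + t *\<^sub>R y - f x1) - (y0 - f x2))"
          using t by (simp add: x_def f.scaleR f.diff algebra_simps)
        then have "norm (y - f x) = norm ((y0 + t *\<^sub>R y - f x1) - (y0 - f x2)) / t"
          using t by simp
        also have "\<dots> \<le> (r / 2) / t"
          using x t norm_triangle_ineq4[of "y0 + t *\<^sub>R y - f x1" "y0 - f x2"]
          by (intro divide_right_mono) auto
        also have "\<dots> = norm y / 2"
          using t False by (simp add: field_simps)
        finally show ?thesis .
      qed
      ultimately show ?thesis
        by blast
    qed
  qed
qed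

text \<open>
  The error of an approximate preimage is approximated in turn. The errors decrease like powers
  of \<open>1/2\<close>, so the corrections add up to an exact preimage, which lies in \<open>C\<close> because \<open>C\<close> is
  closed.
\<close>

lemma surj_on_closed_subspace_bounded_preimage:
  fixes f :: "'a::banach \<Rightarrow> 'b::banach"
  assumes f: "bounded_linear f" and C: "subspace C" "closed C" and surj: "f ` C = UNIV"
  shows "\<exists>K>0. \<forall>y. \<exists>x\<in>C. f x = y \<and> norm x \<le> K * norm y"
proof -
  interpret f: bounded_linear f by fact
  obtain K h where K: "K > 0" and h: "\<And>y. h y \<in> C" "\<And>y. norm (h y) \<le> K * norm y"
      "\<And>y. norm (y - f (h y)) \<le> norm y / 2"
    using surj_on_subspace_almost_open[OF f C(1) surj] by metis
  show ?thesis
  proof (intro exI[of _ "2 * K"] conjI allI)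
    show "2 * K > 0"
      using K by simp
    fix y
    \<comment> \<open>\<open>R n\<close> is the error left after \<open>n\<close> corrections\<close>
    define R where "R n = ((\<lambda>z. z - f (h z)) ^^ n) y" for n
    have R_Suc: "R (Suc n) = R n - f (h (R n))" for n
      by (simp add: R_def)
    have R_le: "norm (R n) \<le> norm y * (1/2) ^ n" for n
    proof (induction n)
      case (Suc n)
      then show ?case
        using h(3)[of "R n"] by (simp add: R_Suc)
    qed (simp add: R_def)
    have h_le: "norm (h (R n)) \<le> K * norm y * (1/2) ^ n" for n
      using order_trans[OF h(2)[of "R n"] mult_left_mono[OF R_le[of n], of K]] K
      by (simp add: mult.assoc)
    have geo: "(\<lambda>n. K * norm y * (1/2) ^ n) sums (K * norm y * 2)"
      using geometric_sums[of "1/2 :: real"] by (intro sums_mult) simp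
    have sm: "summable (\<lambda>n. norm (h (R n)))"
      by (rule summable_comparison_test'[OF sums_summable[OF geo]]) (use h_le in simp)
    define x where "x = (\<Sum>n. h (R n))"
    have x: "(\<lambda>n. \<Sum>i<n. h (R i)) \<longlonglongrightarrow> x"
      using summable_LIMSEQ[OF summable_norm_cancel[OF sm]] by (simp add: x_def)
    have "x \<in> C"
      by (rule closed_sequentially[OF C(2) _ x]) (intro subspace_sum C h)
    moreover have "f x = y"
    proof -
      have partial: "f (\<Sum>i<n. h (R i)) = y - R n" for n
        by (induction n) (simp_all add: f.zero f.add R_Suc, simp add: R_def)
      have "(\<lambda>n. norm y * (1/2) ^ n) \<longlonglongrightarrow> norm y * 0"
        by (intro tendsto_mult_left LIMSEQ_power_zero) simp
      then have "R \<longlonglongrightarrow> 0"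
        by (intro Lim_null_comparison[of R]) (use R_le in auto)
      then have "(\<lambda>n. f (\<Sum>i<n. h (R i))) \<longlonglongrightarrow> y - 0"
        unfolding partial by (intro tendsto_diff tendsto_const)
      moreover have "(\<lambda>n. f (\<Sum>i<n. h (R i))) \<longlonglongrightarrow> f x"
        by (rule f.tendsto[OF x])
      ultimately show ?thesis
        using LIMSEQ_unique by fastforce
    qed
    moreover have "norm x \<le> 2 * K * norm y"
    proof -
      have "norm x \<le> (\<Sum>n. norm (h (R n)))"
        unfolding x_def by (rule summable_norm[OF sm])
      also have "\<dots> \<le> (\<Sum>n. K * norm y * (1/2) ^ n)"
        by (rule suminf_le[OF h_le sm sums_summable[OF geo]])
      also have "\<dots> = 2 * K * norm y"
        using sums_unique[OF geo] by simp
      finally show ?thesis .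
    qed
    ultimately show "\<exists>x\<in>C. f x = y \<and> norm x \<le> 2 * K * norm y"
      by blast
  qed
qed

text \<open>
  With \<open>h\<close> for the inverse of \<open>f\<close> on \<open>C\<close>, the equation \<open>f x + g x = y\<close> says that \<open>x\<close> is a fixed
  point of \<open>\<lambda>x. h (y - g x)\<close>. This is a contraction of \<open>C\<close> if \<open>g\<close> is small, so there is exactly
  one solution for every \<open>y\<close>.
\<close>

lemma bij_on_closed_subspace_perturb:
  fixes f :: "'a::banach \<Rightarrow> 'b::banach"
  assumes f: "bounded_linear f" and C: "subspace C" "closed C" and bij: "bij_betw f C UNIV"
  shows "\<exists>c>0. \<forall>g :: 'a \<Rightarrow> 'b. bounded_linear g \<and> onorm g < c \<longrightarrow> bij_betw (\<lambda>x. f x + g x) C UNIV"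
proof -
  interpret f: bounded_linear f by fact
  have surj: "f ` C = UNIV"
    using bij by (simp add: bij_betw_def)
  obtain K h where K: "K > 0" and h: "\<And>y. h y \<in> C" "\<And>y. f (h y) = y" "\<And>y. norm (h y) \<le> K * norm y"
    using surj_on_closed_subspace_bounded_preimage[OF f C surj] by metis
  have h_eqI: "h y = x" if "x \<in> C" "f x = y" for x y
    using bij that h(1,2)[of y] by (auto simp: bij_betw_def inj_on_def)
  have h_diff: "h y - h z = h (y - z)" for y z
    by (rule sym, rule h_eqI) (auto simp: f.diff h subspace_diff C)
  show ?thesis
  proof (intro exI[of _ "1 / K"] conjI allI impI)
    show "1 / K > 0"
      using K by simp
    fix g :: "'a \<Rightarrow> 'b" assume g': "bounded_linear g \<and> onorm g < 1 / K"
    then interpret g: bounded_linear g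
      by simp
    have "\<exists>!x\<in>C. f x + g x = y" for y
    proof -
      have eq: "h (y - g x) = x \<longleftrightarrow> f x + g x = y" if "x \<in> C" for x
        using h(2)[of "y - g x"] h_eqI[OF that, of "y - g x"] by (auto simp: algebra_simps)
      have "\<exists>!x\<in>C. h (y - g x) = x"
      proof (rule Banach_fix)
        show "complete C" "C \<noteq> {}" "(\<lambda>x. h (y - g x)) ` C \<subseteq> C"
          using C h(1) by (auto simp: complete_eq_closed)
        show "0 \<le> K * onorm g" "K * onorm g < 1"
          using K g' onorm_pos_le[of g] by (auto simp: field_simps)
        fix x x'
        have "dist (h (y - g x)) (h (y - g x')) = norm (h (g (x' - x)))"
          by (simp add: dist_norm h_diff g.diff)
        also have "\<dots> \<le> K * norm (g (x' - x))"
          by (rule h)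
        also have "\<dots> \<le> K * (onorm g * norm (x' - x))"
          using K g' by (intro mult_left_mono onorm) auto
        finally show "dist (h (y - g x)) (h (y - g x')) \<le> K * onorm g * dist x x'"
          by (simp add: dist_norm norm_minus_commute)
      qed
      then show ?thesis
        using eq by blast
    qed
    then show "bij_betw (\<lambda>x. f x + g x) C UNIV"
      unfolding bij_betw_def inj_on_def by (metis (mono_tags, lifting) UNIV_eq_I image_eqI)
  qed
qed

section \<open>Stability of the index\<close>

lemma bounded_right_linear_imp:
  assumes "bounded_right_linear f"
  shows "bounded_linear f" and "right_linear f"
  using assms by (auto simp: bounded_right_linear_def right_linear_def linear_simps)

lemma fredholm_iff_quotient_dim:
  assumes "bounded_right_linear f"
  shows "fredholm f \<longleftrightarrow>
    (\<exists>k l. quotient_dim {0} {x. f x = 0} k \<and> quotient_dim (range f) UNIV l)"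
proof -
  have f: "right_linear f"
    by (rule bounded_right_linear_imp[OF assms])
  have "right_subspace (range f)"
    by (rule right_subspace_image[OF f right_subspace_UNIV])
  then show ?thesis
    using assms
      finite_qdim_iff_quotient_dim[OF quotient_dim_ker_iff_qbasis[OF f]]
      finite_qdim_iff_quotient_dim[OF quotient_dim_coset_iff_qbasis, of "range f"]
    by (simp add: fredholm_def coker_qspace_def)
qed

lemma fredholm_index_eq_quotient_dim:
  assumes f: "right_linear f"
    and "quotient_dim {0} {x. f x = 0} k" "quotient_dim (range f) UNIV l"
  shows "fredholm_index f = int k - int l"
proof -
  have "right_subspace (range f)"
    by (rule right_subspace_image[OF f right_subspace_UNIV])
  then show ?thesis
    using assms(2,3)
      qdim_eq_quotient_dim[OF quotient_dim_ker_iff_qbasis[OF f]]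
      qdim_eq_quotient_dim[OF quotient_dim_coset_iff_qbasis, of "range f"]
    by (simp add: fredholm_index_def coker_qspace_def)
qed

lemma finite_dim_closed_complement:
  fixes K :: "'a::right_qhilbert set"
  assumes "quotient_dim {0} K n"
  shows "\<exists>M. closed M \<and> right_subspace M \<and> M \<inter> K = {0} \<and> M + K = UNIV"
proof -
  obtain P where P: "bounded_linear P" "right_linear P" "\<And>x. P x \<in> K" "\<And>x. x \<in> K \<Longrightarrow> P x = x"
    using finite_dim_projection[OF assms] by blast
  interpret P: bounded_linear P by fact
  let ?M = "{x. P x = 0}"
  have "closed ?M"
    by (intro closed_Collect_eq continuous_on_const linear_continuous_on P(1))
  moreover have "right_subspace ?M"
    by (rule right_subspace_vimage_zero[OF P(2)])
  moreover have "?M \<inter> K = {0}"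
    using P(4) right_subspace_0[OF quotient_dim_right_subspace(2)[OF assms]] by (auto simp: P.zero)
  moreover have "x \<in> ?M + K" for x
  proof -
    have "(x - P x) + P x \<in> ?M + K"
      using P(3,4) by (intro set_plus_intro) (simp_all add: P.diff)
    then show ?thesis
      by simp
  qed
  then have "?M + K = UNIV"
    by blast
  ultimately show ?thesis
    by blast
qed

lemma finite_dim_closed:
  fixes Z :: "'a::right_qhilbert set"
  assumes "quotient_dim {0} Z n"
  shows "closed Z"
proof -
  obtain P where P: "bounded_linear P" "\<And>x. P x \<in> Z" "\<And>x. x \<in> Z \<Longrightarrow> P x = x"
    using finite_dim_projection[OF assms] by blast
  have "x \<in> Z \<longleftrightarrow> P x = x" for x
    using P(2)[of x] P(3)[of x] by auto
  then have "Z = {x. P x = x}"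
    by blast
  moreover have "closed {x. P x = x}"
    by (intro closed_Collect_eq continuous_on_id linear_continuous_on P(1))
  ultimately show ?thesis
    by simp
qed

text \<open>
  The hypothesis says that \<open>B\<close> is injective on \<open>M\<close> and that \<open>Z\<close> is a complement of \<open>B M\<close>. Hence
  \<open>U / B M\<close> has the dimension of \<open>Z\<close>, and the index is \<open>dim (V / M) - dim Z\<close>, whatever \<open>B\<close> is.
\<close>

lemma fredholm_index_of_complements:
  fixes B :: "'v::right_qhilbert \<Rightarrow> 'u::right_qhilbert"
  assumes B: "bounded_right_linear B"
    and M: "quotient_dim M UNIV k" and Z: "quotient_dim {0} Z l"
    and bij: "bij_betw (\<lambda>p. B (fst p) + snd p) (M \<times> Z) UNIV"
  shows "fredholm B \<and> fredholm_index B = int k - int l"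
proof -
  note BL = bounded_right_linear_imp(2)[OF B]
  note MS = quotient_dim_right_subspace(1)[OF M]
  note ZS = quotient_dim_right_subspace(2)[OF Z]
  note zero = right_linear_0[OF BL]
  have inj: "m = m' \<and> z = z'"
    if "m \<in> M" "m' \<in> M" "z \<in> Z" "z' \<in> Z" "B m + z = B m' + z'" for m m' z z'
    using bij that unfolding bij_betw_def inj_on_def by fastforce
  have ker: "M \<inter> {x. B x = 0} = {0}"
    using inj[of _ 0 0 0] right_subspace_0[OF MS] right_subspace_0[OF ZS] zero by auto
  have "B ` M \<inter> Z = {0}"
  proof -
    have "B m = 0" if "m \<in> M" "B m \<in> Z" for m
      using inj[of m 0 0 "B m"] that right_subspace_0[OF MS] right_subspace_0[OF ZS] zero by simp
    then show ?thesis
      using right_subspace_0[OF ZS] right_subspace_0[OF right_subspace_image[OF BL MS]] by blast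
  qed
  moreover have "B ` M + Z = UNIV"
  proof -
    have "y \<in> B ` M + Z" for y
    proof -
      have "y \<in> (\<lambda>p. B (fst p) + snd p) ` (M \<times> Z)"
        using bij by (simp add: bij_betw_def)
      then show ?thesis
        by auto
    qed
    then show ?thesis
      by blast
  qed
  ultimately have BM: "quotient_dim (B ` M) UNIV l"
    using quotient_dim_of_complement[OF right_subspace_image[OF BL MS] Z] by simp
  obtain k' l' where "quotient_dim {0} {x. B x = 0} k'" "quotient_dim (range B) UNIV l'"
      "k' + l = k + l'"
    using quotient_dim_ker_coker[OF BL M BM ker] by blast
  then show ?thesis
    using fredholm_iff_quotient_dim[OF B] fredholm_index_eq_quotient_dim[OF BL] by auto
qed

theorem theorem6p20:
  fixes A :: "'v::right_qhilbert \<Rightarrow> 'u::right_qhilbert"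
  assumes "separable_space (euclidean :: 'v topology)"
    and "separable_space (euclidean :: 'u topology)"
    and "fredholm A"
  shows "\<exists>c>0. \<forall>S::'v \<Rightarrow> 'u. bounded_right_linear S \<and> onorm S < c \<longrightarrow>
           fredholm (\<lambda>x. A x + S x) \<and> fredholm_index (\<lambda>x. A x + S x) = fredholm_index A"
proof -
  have A: "bounded_right_linear A"
    using assms(3) by (simp add: fredholm_def)
  note Ab = bounded_right_linear_imp(1)[OF A] and Al = bounded_right_linear_imp(2)[OF A]
  let ?K = "{x. A x = 0}"
  obtain k l where k: "quotient_dim {0} ?K k" and l: "quotient_dim (range A) UNIV l"
    using assms(3) fredholm_iff_quotient_dim[OF A] by blast
  obtain M where M: "closed M" "right_subspace M" "M \<inter> ?K = {0}" "M + ?K = UNIV"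
    using finite_dim_closed_complement[OF k] by blast
  have Mk: "quotient_dim M UNIV k"
    using quotient_dim_of_complement[OF M(2) k M(3)] M(4) by simp
  obtain Z where Z: "quotient_dim {0} Z l" "range A \<inter> Z = {0}" "range A + Z = UNIV"
    using quotient_dim_complement[OF l] by blast
  note ZS = quotient_dim_right_subspace(2)[OF Z(1)]
  \<comment> \<open>\<open>A\<close> bordered by the inclusion of \<open>Z\<close>, which makes it invertible on \<open>M \<times> Z\<close>\<close>
  let ?f = "\<lambda>p. A (fst p) + snd p"
  have f: "bounded_linear ?f"
    by (intro bounded_linear_add bounded_linear_snd bounded_linear_compose[OF Ab] bounded_linear_fst)
  have C: "subspace (M \<times> Z)" "closed (M \<times> Z)"
    by (intro subspace_Times right_subspace_real_subspace M ZS)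
      (intro closed_Times M finite_dim_closed[OF Z(1)])
  have bij: "bij_betw ?f (M \<times> Z) UNIV"
    unfolding bij_betw_def
  proof
    show "inj_on ?f (M \<times> Z)"
    proof (rule inj_onI, clarsimp)
      fix m z m' z' assume p: "m \<in> M" "m' \<in> M" "z \<in> Z" "z' \<in> Z" "A m + z = A m' + z'"
      then have "A (m - m') = z' - z"
        by (simp add: right_linear_diff[OF Al] algebra_simps)
      then have "A (m - m') \<in> range A \<inter> Z"
        using right_subspace_diff[OF ZS p(4,3)] by (metis IntI rangeI)
      then have "A (m - m') = 0"
        using Z(2) by simp
      then have "m - m' \<in> M \<inter> ?K"
        using right_subspace_diff[OF M(2) p(1,2)] by simp
      then have "m = m'"
        using M(3) by simp
      then show "m = m' \<and> z = z'"
        using p(5) by simp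
    qed
    have "y \<in> ?f ` (M \<times> Z)" for y
    proof -
      have "y \<in> range A + Z"
        using Z(3) by blast
      then obtain v z where z: "z \<in> Z" "y = A v + z"
        by (auto elim: set_plus_elim)
      have "v \<in> M + ?K"
        using M(4) by blast
      then obtain m x where m: "m \<in> M" "A x = 0" "v = m + x"
        by (auto elim: set_plus_elim)
      have "y = ?f (m, z)"
        using z m by (simp add: right_linear_add[OF Al])
      then show ?thesis
        using z m by blast
    qed
    then show "?f ` (M \<times> Z) = UNIV"
      by blast
  qed
  obtain c where c: "c > 0" "\<And>g. bounded_linear g \<Longrightarrow> onorm g < c \<Longrightarrow>
      bij_betw (\<lambda>p. ?f p + g p) (M \<times> Z) UNIV"
    using bij_on_closed_subspace_perturb[OF f C bij] by blast
  have "fredholm (\<lambda>x. A x + S x) \<and> fredholm_index (\<lambda>x. A x + S x) = fredholm_index A"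
    if S: "bounded_right_linear S" "onorm S < c" for S :: "'v \<Rightarrow> 'u"
  proof -
    note Sb = bounded_right_linear_imp(1)[OF S(1)]
    have "bounded_right_linear (\<lambda>x. A x + S x)"
      using A S(1) by (auto simp: bounded_right_linear_def scaleQ_add_left intro: bounded_linear_add)
    moreover have "bij_betw (\<lambda>p. (A (fst p) + S (fst p)) + snd p) (M \<times> Z) UNIV"
    proof -
      have "onorm (\<lambda>p :: 'v \<times> 'u. S (fst p)) \<le> onorm S"
      proof (rule onorm_bound)
        fix p :: "'v \<times> 'u"
        have "norm (S (fst p)) \<le> onorm S * norm (fst p)"
          by (rule onorm[OF Sb])
        also have "\<dots> \<le> onorm S * norm p"
          using norm_fst_le[of "fst p" "snd p"] by (intro mult_left_mono onorm_pos_le Sb) simp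
        finally show "norm (S (fst p)) \<le> onorm S * norm p" .
      qed (rule onorm_pos_le[OF Sb])
      then have "bij_betw (\<lambda>p. ?f p + S (fst p)) (M \<times> Z) UNIV"
        using S(2) by (intro c(2) bounded_linear_compose[OF Sb] bounded_linear_fst) auto
      then show ?thesis
        by (simp add: ac_simps)
    qed
    ultimately have "fredholm (\<lambda>x. A x + S x) \<and> fredholm_index (\<lambda>x. A x + S x) = int k - int l"
      by (rule fredholm_index_of_complements[OF _ Mk Z(1)])
    then show ?thesis
      using fredholm_index_eq_quotient_dim[OF Al k l] by simp
  qed
  then show ?thesis
    using c(1) by blast
qed

end
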